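(* Let $G=(V,E)$ be a finite undirected graph (loops and multiple edges allowed), let $S:=\{(v,i)\in V\times\mathbb{N} \mid 1\leq i\leq \deg_G(v)\}$, and let $r:2^S\to\mathbb{Z}$ be the function defined by $$r(X):=\max\{\mathrm{Hei}(\varphi)\mid \varphi \text{ is a labeling of } G \text{ with respect to } \alpha(X)\}.$$ Then: (a) $r$ is the rank function of a matroid $M=(S,r)$ on the ground set $S$, and $M$ is an identically self-dual (i.e. $M^\ast=M$) transversal matroid of rank $|E|$. (b) For every perfect subset $X$ of $S$, the deletion $M\backslash X$ is a bi-transversal matroid.
   Context: Degree: $\deg_G(v)$ is the number of edges incident to $v$, where a loop at $v$ contributes $2$. Labelings: let $\infty$ be a symbol with $\infty\notin V$, and let $\alpha=(m(v),\,v\in V)$ be a vector of non-negative integers. A labeling of $G$ with respect to $\alpha$ is a map $\varphi:E\to V\cup\{\infty\}$ such that (i) for every $e\in E$ with ends $v$ and $w$, $\varphi(e)\in\{v,w,\infty\}$; and (ii) $|\varphi^{-1}(v)|\leq m(v)$ for each $v\in V$. Its height is $\mathrm{Hei}(\varphi):=|\{e\in E\mid \varphi(e)\neq\infty\}|$. $\alpha$-vector: for $X\subseteq S$, $\alpha(X):=(m_X(v),\,v\in V)$, where $m_X(v):=|\{i\mid (v,i)\in X\}|$. Perfect subsets: $X\subseteq S$ is perfect if there is $W\subseteq V$ with $X=\{(v,i)\in W\times\mathbb{N}\mid 1\leq i\leq\deg_G(v)\}$. Matroids: $M^\ast$ denotes the dual and $M\backslash X$ the deletion of $X$. A matroid on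 a finite set $S$ is transversal if there is a finite family $(A_1,\dots,A_n)$ of subsets of $S$ (repetitions allowed) such that its independent sets are exactly the partial transversals, i.e. the sets $I\subseteq S$ admitting an injection $f:I\to\{1,\dots,n\}$ with $x\in A_{f(x)}$ for all $x\in I$. A matroid is bi-transversal if both it and its dual are transversal. *)

theory Defs
  imports "HOL-Library.Uprod" "HOL-Library.FuncSet"
begin

section \<open>Matroids given by rank functions\<close>

record 'a matroid =
  ground :: "'a set"
  rk :: "'a set \<Rightarrow> int"

text \<open>The rank function is a map on the subsets of the ground set only. It is kept
  extensional, so that equality of records is equality of matroids.\<close>

definition is_matroid :: "'a matroid \<Rightarrow> bool" where
  "is_matroid M \<longleftrightarrow>
     finite (ground M) \<and>
     rk M \<in> extensional (Pow (ground M)) \<and>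
     (\<forall>X. X \<subseteq> ground M \<longrightarrow> 0 \<le> rk M X \<and> rk M X \<le> int (card X)) \<and>
     (\<forall>X Y. X \<subseteq> Y \<and> Y \<subseteq> ground M \<longrightarrow> rk M X \<le> rk M Y) \<and>
     (\<forall>X Y. X \<subseteq> ground M \<and> Y \<subseteq> ground M \<longrightarrow>
        rk M (X \<union> Y) + rk M (X \<inter> Y) \<le> rk M X + rk M Y)"

definition indep :: "'a matroid \<Rightarrow> 'a set \<Rightarrow> bool" where
  "indep M I \<longleftrightarrow> I \<subseteq> ground M \<and> rk M I = int (card I)"

definition matroid_dual :: "'a matroid \<Rightarrow> 'a matroid" where
  "matroid_dual M =
     \<lparr>ground = ground M,
      rk = restrict (\<lambda>X. int (card X) + rk M (ground M - X) - rk M (ground M))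
             (Pow (ground M))\<rparr>"

definition deletion :: "'a matroid \<Rightarrow> 'a set \<Rightarrow> 'a matroid" where
  "deletion M X =
     \<lparr>ground = ground M - X, rk = restrict (rk M) (Pow (ground M - X))\<rparr>"

definition partial_transversal :: "nat \<Rightarrow> (nat \<Rightarrow> 'a set) \<Rightarrow> 'a set \<Rightarrow> bool" where
  "partial_transversal n A I \<longleftrightarrow>
     (\<exists>f. inj_on f I \<and> (\<forall>x\<in>I. f x \<in> {1..n} \<and> x \<in> A (f x)))"

definition transversal :: "'a matroid \<Rightarrow> bool" where
  "transversal M \<longleftrightarrow>
     is_matroid M \<and>
     (\<exists>n A. (\<forall>j\<in>{1..n}. A j \<subseteq> ground M) \<and>
        (\<forall>I. I \<subseteq> ground M \<longrightarrow> (indep M I \<longleftrightarrow> partial_transversal n A I)))"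

definition bi_transversal :: "'a matroid \<Rightarrow> bool" where
  "bi_transversal M \<longleftrightarrow> transversal M \<and> transversal (matroid_dual M)"


section \<open>Multigraphs and their labelings\<close>

record ('v, 'e) multigraph =
  verts :: "'v set"
  edges :: "'e set"
  ends :: "'e \<Rightarrow> 'v uprod"

definition finite_multigraph :: "('v, 'e) multigraph \<Rightarrow> bool" where
  "finite_multigraph G \<longleftrightarrow>
     finite (verts G) \<and> finite (edges G) \<and>
     (\<forall>e\<in>edges G. set_uprod (ends G e) \<subseteq> verts G)"

text \<open>A loop is counted once by each summand.\<close>

definition vdeg :: "('v, 'e) multigraph \<Rightarrow> 'v \<Rightarrow> nat" where
  "vdeg G v =
     card {e \<in> edges G. v \<in> set_uprod (ends G e)} +
     card {e \<in> edges G. ends G e = Upair v v}"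

text \<open>The symbol \<open>\<infinity>\<close> is \<^const>\<open>None\<close>, and a vertex \<open>v\<close> used as a label is \<open>Some v\<close>.\<close>

definition labeling :: "('v, 'e) multigraph \<Rightarrow> ('v \<Rightarrow> nat) \<Rightarrow> ('e \<Rightarrow> 'v option) \<Rightarrow> bool" where
  "labeling G m \<phi> \<longleftrightarrow>
     \<phi> \<in> edges G \<rightarrow>\<^sub>E insert None (Some ` verts G) \<and>
     (\<forall>e\<in>edges G. \<phi> e \<in> insert None (Some ` set_uprod (ends G e))) \<and>
     (\<forall>v\<in>verts G. card {e \<in> edges G. \<phi> e = Some v} \<le> m v)"

definition height :: "('v, 'e) multigraph \<Rightarrow> ('e \<Rightarrow> 'v option) \<Rightarrow> nat" where
  "height G \<phi> = card {e \<in> edges G. \<phi> e \<noteq> None}"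

definition slots :: "('v, 'e) multigraph \<Rightarrow> 'v set \<Rightarrow> ('v \<times> nat) set" where
  "slots G W = {(v, i). v \<in> W \<and> 1 \<le> i \<and> i \<le> vdeg G v}"

definition alpha :: "('v \<times> nat) set \<Rightarrow> 'v \<Rightarrow> nat" where
  "alpha X v = card {i. (v, i) \<in> X}"

definition label_rank :: "('v, 'e) multigraph \<Rightarrow> ('v \<times> nat) set \<Rightarrow> int" where
  "label_rank G X = int (Max {height G \<phi> |\<phi>. labeling G (alpha X) \<phi>})"

definition label_matroid :: "('v, 'e) multigraph \<Rightarrow> ('v \<times> nat) matroid" where
  "label_matroid G =
     \<lparr>ground = slots G (verts G),
      rk = restrict (label_rank G) (Pow (slots G (verts G)))\<rparr>"

definition perfect :: "('v, 'e) multigraph \<Rightarrow> ('v \<times> nat) set \<Rightarrow> bool" where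
  "perfect G X \<longleftrightarrow> (\<exists>W. W \<subseteq> verts G \<and> X = slots G W)"

end

theory Submission
  imports Defs
begin

text \<open>A labeling with respect to \<open>\<alpha>(X)\<close> of height \<open>k\<close> is the same as a matching of \<open>k\<close> edges with
  slots in \<open>X\<close>, where an edge may use the slots of its ends. Hence \<open>r\<close> is the rank function of a
  transversal matroid. A basis is an orientation of all edges, and assigning each edge to its other
  end instead shows that the complement of a basis is a basis. For perfect \<open>X\<close> the dual of the deletion
  is the contraction of \<open>X\<close>, which is presented by the edges having no end in the deleted
  vertex set.\<close>

section \<open>Rank functions of independence systems with augmentation\<close>

text \<open>This is the matroid rank of \<open>X\<close> when \<open>P\<close> is independence. For
  finite \<open>X\<close> with \<open>P {}\<close> the set under \<open>Max\<close> is finite and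
  nonempty, so the maximum is attained.\<close>

definition max_card :: "('a set \<Rightarrow> bool) \<Rightarrow> 'a set \<Rightarrow> nat" where
  "max_card P X = Max (card ` {I. I \<subseteq> X \<and> P I})"

text \<open>The independence axioms without a ground set: finiteness is asked only of the two sets
  compared, so ranks can be formed on every finite set.\<close>

locale augmentable =
  fixes P :: "'a set \<Rightarrow> bool"
  assumes P_empty: "P {}"
    and P_subset: "P J \<Longrightarrow> I \<subseteq> J \<Longrightarrow> P I"
    and P_augment: "\<lbrakk>P I; P J; finite I; finite J; card I < card J\<rbrakk>
      \<Longrightarrow> \<exists>x\<in>J - I. P (insert x I)"
begin

lemma max_card_ge: "finite X \<Longrightarrow> I \<subseteq> X \<Longrightarrow> P I \<Longrightarrow> card I \<le> max_card P X"
  unfolding max_card_def by (rule Max_ge) auto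

lemma max_card_witness:
  assumes "finite X"
  obtains I where "I \<subseteq> X" "P I" "card I = max_card P X"
proof -
  have "max_card P X \<in> card ` {I. I \<subseteq> X \<and> P I}"
    unfolding max_card_def using assms P_empty by (intro Max_in) auto
  then show ?thesis using that by force
qed

text \<open>Augment \<open>I\<close> repeatedly from a maximum independent subset \<open>B\<close>
  of \<open>X\<close>. Each added element stays in \<open>X\<close> and shrinks the gap to
  \<open>max_card P X\<close>, which is the induction measure.\<close>

lemma extend_to_max_card:
  assumes "finite X" "I \<subseteq> X" "P I"
  obtains J where "I \<subseteq> J" "J \<subseteq> X" "P J" "card J = max_card P X"
proof -
  have "\<exists>J. I \<subseteq> J \<and> J \<subseteq> X \<and> P J \<and> card J = max_card P X"
    using assms(2,3)
  proof (induction "max_card P X - card I" arbitrary: I rule: less_induct)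
    case less
    obtain B where B: "B \<subseteq> X" "P B" "card B = max_card P X"
      using max_card_witness assms(1) by blast
    have le: "card I \<le> max_card P X" using max_card_ge assms(1) less.prems by blast
    show ?case
    proof (cases "card I = max_card P X")
      case False
      then have lt: "card I < card B" using le B by simp
      obtain x where x: "x \<in> B - I" "P (insert x I)"
        using P_augment[of I B] lt less.prems B assms(1) by (meson finite_subset)
      have "card (insert x I) = Suc (card I)"
        using x less.prems assms(1) by (metis DiffD2 card_insert_disjoint finite_subset)
      then have "max_card P X - card (insert x I) < max_card P X - card I"
        using lt B by linarith
      moreover have "insert x I \<subseteq> X" using x B less.prems by blast
      ultimately obtain J where "insert x I \<subseteq> J" "J \<subseteq> X" "P J" "card J = max_card P X"
        using less.hyps[of "insert x I"] x(2) by blast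
      then show ?thesis by blast
    qed (use less.prems in blast)
  qed
  then show ?thesis using that by blast
qed

lemma max_card_le_card: "finite X \<Longrightarrow> max_card P X \<le> card X"
  by (rule max_card_witness[of X]) (auto dest: card_mono)

lemma max_card_mono:
  assumes "finite Y" "X \<subseteq> Y"
  shows "max_card P X \<le> max_card P Y"
proof -
  obtain I where "I \<subseteq> X" "P I" "card I = max_card P X"
    using max_card_witness[of X] assms finite_subset by metis
  then show ?thesis using max_card_ge[of Y I] assms by simp
qed

text \<open>Extend a maximum independent subset \<open>I\<close> of the intersection to a maximum
  one \<open>J\<close> of the union. The traces of \<open>J\<close> on \<open>X\<close> and
  \<open>Y\<close> are independent, cover \<open>J\<close>, and both contain
  \<open>I\<close>.\<close>

lemma max_card_submodular:
  assumes "finite X" "finite Y"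
  shows "max_card P (X \<union> Y) + max_card P (X \<inter> Y) \<le> max_card P X + max_card P Y"
proof -
  obtain I where I: "I \<subseteq> X \<inter> Y" "P I" "card I = max_card P (X \<inter> Y)"
    using max_card_witness[of "X \<inter> Y"] assms(1) finite_Int by metis
  obtain J where J: "I \<subseteq> J" "J \<subseteq> X \<union> Y" "P J" "card J = max_card P (X \<union> Y)"
  proof (rule extend_to_max_card[of "X \<union> Y" I])
    show "finite (X \<union> Y)" "I \<subseteq> X \<union> Y" "P I" using I assms by auto
  qed
  have fJ: "finite J" using J assms by (meson finite_UnI finite_subset)
  have "card I \<le> card ((J \<inter> X) \<inter> (J \<inter> Y))" using I J fJ by (intro card_mono) auto
  moreover have "J = (J \<inter> X) \<union> (J \<inter> Y)" using J by auto
  ultimately have "card J + card I \<le> card (J \<inter> X) + card (J \<inter> Y)"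
    using card_Un_Int[of "J \<inter> X" "J \<inter> Y"] fJ by simp
  moreover have "card (J \<inter> X) \<le> max_card P X" "card (J \<inter> Y) \<le> max_card P Y"
    using max_card_ge[OF _ Int_lower2] P_subset[OF J(3) Int_lower1] assms by simp_all
  ultimately show ?thesis using I J by simp
qed

lemma max_card_eq_card_iff:
  assumes "finite X"
  shows "max_card P X = card X \<longleftrightarrow> P X"
proof
  assume "max_card P X = card X"
  moreover obtain I where "I \<subseteq> X" "P I" "card I = max_card P X"
    using max_card_witness assms by blast
  ultimately show "P X" using card_subset_eq assms by metis
next
  assume "P X"
  then have "card X \<le> max_card P X" using max_card_ge[OF assms order.refl] by blast
  then show "max_card P X = card X" using max_card_le_card[OF assms] by simp
qed

end


section \<open>Transversal matroids\<close>

text \<open>Partial transversals with an arbitrary index set \<open>F\<close>: edges can serve as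
  indices, and inductions can run over \<open>F\<close>.\<close>

definition transverse :: "'e set \<Rightarrow> ('e \<Rightarrow> 'a set) \<Rightarrow> 'a set \<Rightarrow> bool" where
  "transverse F A I \<longleftrightarrow> (\<exists>f. inj_on f I \<and> (\<forall>x\<in>I. f x \<in> F \<and> x \<in> A (f x)))"

text \<open>Inverts the injection: \<open>D\<close> collects the indices in use and \<open>h\<close>
  sends each to the element it represents. Labelings are functions of edges, so this is the
  direction they need.\<close>

lemma transverse_iff_matching:
  "transverse F A I \<longleftrightarrow> (\<exists>D h. D \<subseteq> F \<and> bij_betw h D I \<and> (\<forall>e\<in>D. h e \<in> A e))"
proof
  assume "transverse F A I"
  then obtain f where f: "inj_on f I" "\<forall>x\<in>I. f x \<in> F \<and> x \<in> A (f x)"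
    unfolding transverse_def by blast
  have "bij_betw (inv_into I f) (f ` I) I"
    using f(1) by (simp add: bij_betw_inv_into inj_on_imp_bij_betw)
  then show "\<exists>D h. D \<subseteq> F \<and> bij_betw h D I \<and> (\<forall>e\<in>D. h e \<in> A e)"
    using f by (intro exI[of _ "f ` I"] exI[of _ "inv_into I f"]) auto
next
  assume "\<exists>D h. D \<subseteq> F \<and> bij_betw h D I \<and> (\<forall>e\<in>D. h e \<in> A e)"
  then obtain D h where h: "D \<subseteq> F" "bij_betw h D I" "\<forall>e\<in>D. h e \<in> A e" by blast
  have "bij_betw (inv_into D h) I D" using h bij_betw_inv_into by blast
  moreover have "\<forall>x\<in>I. h (inv_into D h x) = x"
    using h(2) bij_betw_inv_into_right by fastforce
  ultimately show "transverse F A I" unfolding transverse_def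
    using h by (intro exI[of _ "inv_into D h"]) (metis bij_betw_apply bij_betw_def subsetD)
qed

lemma transverse_empty: "transverse F A {}"
  by (simp add: transverse_def)

lemma transverse_subset: "transverse F A J \<Longrightarrow> I \<subseteq> J \<Longrightarrow> transverse F A I"
  unfolding transverse_def by (meson inj_on_subset subsetD)

lemma transverse_mono: "transverse F A I \<Longrightarrow> F \<subseteq> F' \<Longrightarrow> transverse F' A I"
  unfolding transverse_def by blast

text \<open>Disjoint index sets keep the two injections from colliding; on common elements the first
  injection is used.\<close>

lemma transverse_union:
  assumes "transverse F A I" "transverse F' A J" "F \<inter> F' = {}"
  shows "transverse (F \<union> F') A (I \<union> J)"
proof -
  obtain f g where f: "inj_on f I" "\<forall>x\<in>I. f x \<in> F \<and> x \<in> A (f x)"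
    and g: "inj_on g J" "\<forall>x\<in>J. g x \<in> F' \<and> x \<in> A (g x)"
    using assms unfolding transverse_def by blast
  have "inj_on (\<lambda>x. if x \<in> I then f x else g x) (I \<union> J)"
    using f g assms(3) unfolding inj_on_def by (smt (verit) UnE disjoint_iff)
  then show ?thesis unfolding transverse_def
    using f g by (intro exI[of _ "\<lambda>x. if x \<in> I then f x else g x"]) auto
qed

lemma transverse_singleton: "a \<in> A e \<Longrightarrow> transverse {e} A {a}"
  unfolding transverse_def by auto

text \<open>By injectivity the new index \<open>e\<close> is either idle or represents exactly one
  element \<open>a\<close>. This drives the induction for augmentation.\<close>

lemma transverse_insert_index:
  assumes "e \<notin> F"
  shows "transverse (insert e F) A I \<longleftrightarrow>
    transverse F A I \<or> (\<exists>a\<in>I. a \<in> A e \<and> transverse F A (I - {a}))"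
proof
  assume "transverse (insert e F) A I"
  then obtain f where f: "inj_on f I" "\<forall>x\<in>I. f x \<in> insert e F \<and> x \<in> A (f x)"
    unfolding transverse_def by blast
  show "transverse F A I \<or> (\<exists>a\<in>I. a \<in> A e \<and> transverse F A (I - {a}))"
  proof (cases "e \<in> f ` I")
    case True
    then obtain a where a: "a \<in> I" "f a = e" by blast
    have "\<forall>x\<in>I - {a}. f x \<in> F \<and> x \<in> A (f x)"
      using f a by (metis DiffE inj_onD insertE insertI1)
    then have "transverse F A (I - {a})" unfolding transverse_def
      using f(1) by (meson Diff_subset inj_on_subset)
    then show ?thesis using a f by auto
  next
    case False
    then show ?thesis using f unfolding transverse_def by (metis imageI insertE)
  qed
next
  assume "transverse F A I \<or> (\<exists>a\<in>I. a \<in> A e \<and> transverse F A (I - {a}))"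
  then show "transverse (insert e F) A I"
  proof
    assume "\<exists>a\<in>I. a \<in> A e \<and> transverse F A (I - {a})"
    then obtain a where a: "a \<in> I" "a \<in> A e" "transverse F A (I - {a})" by blast
    then show ?thesis
      using transverse_union[of "{e}" A "{a}" F "I - {a}"] transverse_singleton[of a A e] a assms
      by (simp add: insert_absorb)
  qed (auto intro: transverse_mono)
qed

text \<open>Removing the index \<open>e\<close> costs each of \<open>I\<close> and \<open>J\<close> at most one element. If an augmentation for the
  remaining indices only gives back the element removed from \<open>I\<close>, then \<open>I\<close> does not need \<open>e\<close>,
  and \<open>e\<close> is free to absorb one element of \<open>J\<close>.\<close>

lemma transverse_augment:
  assumes "finite F" "transverse F A I" "transverse F A J" "finite I" "finite J" "card I < card J"
  shows "\<exists>x\<in>J - I. transverse F A (insert x I)"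
  using assms
proof (induction F arbitrary: I J rule: finite_induct)
  case empty
  then show ?case unfolding transverse_def by (metis card.empty equals0I empty_iff less_nat_zero_code)
next
  case (insert e F)
  note split = transverse_insert_index[OF insert.hyps(2), of A]
  have splitI: "transverse (insert e F) A K"
    if "a \<in> K" "a \<in> A e" "transverse F A (K - {a})" for a K
    unfolding split using that by blast
  \<comment> \<open>\<open>J0\<close> is represented by the indices in \<open>F\<close> alone; it
    misses at most the one element of \<open>J\<close> that uses \<open>e\<close>.\<close>
  obtain J0 where J0: "J0 \<subseteq> J" "transverse F A J0" "J0 = J \<or> (\<exists>b\<in>J. b \<in> A e \<and> J0 = J - {b})"
    using insert.prems(2) unfolding split by blast
  have fin: "finite J0" using J0 insert.prems finite_subset by blast
  have cJ0: "card J \<le> Suc (card J0)"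
    using J0(3) insert.prems(4) by (auto simp: card_Diff_singleton)
  have aug: "\<exists>x\<in>J - I. transverse (insert e F) A (insert x I)" if I: "transverse F A I"
  proof (cases "card I < card J0")
    case True
    then obtain x where "x \<in> J0 - I" "transverse F A (insert x I)"
      using insert.IH[OF I J0(2) insert.prems(3) fin] by blast
    then show ?thesis using J0(1) transverse_mono[of F A "insert x I" "insert e F"]
      by (intro bexI[of _ x]) auto
  next
    case False
    then obtain b where b: "b \<in> J" "b \<in> A e" "J0 = J - {b}"
      using J0 insert.prems(5) by blast
    show ?thesis
    proof (cases "b \<in> I")
      case bI: True
      \<comment> \<open>Removing \<open>b\<close> from both sides restores the strict inequality
        needed for induction; afterwards \<open>b\<close> returns to \<open>I\<close> with
        \<open>e\<close> as its index.\<close>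
      have "card (I - {b}) < card J0"
        using bI b insert.prems by (simp add: card_Diff_singleton)
          (metis Suc_pred card_gt_0_iff empty_iff less_diff_conv less_SucE Suc_eq_plus1 Suc_less_eq)
      then obtain x where x: "x \<in> J0 - (I - {b})" "transverse F A (insert x (I - {b}))"
        using insert.IH[OF transverse_subset[OF I Diff_subset] J0(2) _ fin] insert.prems(3)
        by blast
      have xb: "x \<noteq> b" "x \<notin> I" "x \<in> J" using x b by auto
      have "insert x I - {b} = insert x (I - {b})" using xb by auto
      then have "transverse (insert e F) A (insert x I)"
        using splitI[of b] x(2) bI b(2) by simp
      then show ?thesis using xb(2,3) by (intro bexI[of _ x]) simp_all
    next
      case bI: False
      then have "insert b I - {b} = I" by auto
      then have "transverse (insert e F) A (insert b I)" using splitI[of b] I b(2) by simp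
      then show ?thesis using b(1) bI by (intro bexI[of _ b]) simp_all
    qed
  qed
  show ?case
  proof (cases "transverse F A I")
    case False
    then obtain a where a: "a \<in> I" "a \<in> A e" "transverse F A (I - {a})"
      using insert.prems(1) unfolding split by blast
    have "card (I - {a}) < card J0"
      using a insert.prems cJ0 by (metis Suc_less_SucD card_Suc_Diff1 order_less_le_trans)
    then obtain x where x: "x \<in> J0 - (I - {a})" "transverse F A (insert x (I - {a}))"
      using insert.IH[OF a(3) J0(2) _ fin] insert.prems(3) by blast
    \<comment> \<open>If \<open>x\<close> were \<open>a\<close>, the augmented set would be
      \<open>I\<close> itself, which in this case is not transverse for \<open>F\<close>.\<close>
    have xa: "x \<noteq> a" using False x(2) a by (metis insert_Diff)
    then have "insert x I - {a} = insert x (I - {a})" by auto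
    then have "transverse (insert e F) A (insert x I)" using splitI[of a] x(2) a(1,2) by simp
    moreover have "x \<in> J - I" using x(1) xa J0(1) by blast
    ultimately show ?thesis by (rule_tac bexI)
  qed (rule aug)
qed

lemma augmentable_transverse: "finite F \<Longrightarrow> augmentable (transverse F A)"
  by unfold_locales
    (simp add: transverse_empty, erule (1) transverse_subset, simp add: transverse_augment)

text \<open>Members of the family may reach outside \<open>S\<close>, since only subsets of
  \<open>S\<close> are ranked. Deletion can thus keep the family and shrink only the ground
  set.\<close>

definition transversal_matroid :: "'a set \<Rightarrow> 'e set \<Rightarrow> ('e \<Rightarrow> 'a set) \<Rightarrow> 'a matroid" where
  "transversal_matroid S F A =
     \<lparr>ground = S, rk = restrict (\<lambda>X. int (max_card (transverse F A) X)) (Pow S)\<rparr>"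

lemma transversal_transversal_matroid:
  assumes "finite S" "finite F"
  shows "transversal (transversal_matroid S F A)"
proof -
  interpret augmentable "transverse F A" using augmentable_transverse assms(2) .
  let ?M = "transversal_matroid S F A"
  have fin: "finite X" if "X \<subseteq> S" for X using that assms(1) finite_subset by blast
  have matroid: "is_matroid ?M"
    unfolding is_matroid_def transversal_matroid_def
    using assms(1) fin max_card_le_card max_card_mono max_card_submodular
    by (auto simp flip: of_nat_add)
  \<comment> \<open>\<open>g\<close> numbers the index set, because \<open>transversal\<close> asks
    for indices in an initial segment of the positive integers; the members are also cut down to
    \<open>S\<close>.\<close>
  obtain g where g: "bij_betw g {1..card F} F"
    using ex_bij_betw_nat_finite_1 assms(2) by blast
  have "indep ?M I \<longleftrightarrow> partial_transversal (card F) (\<lambda>j. A (g j) \<inter> S) I" if "I \<subseteq> S" for I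
  proof -
    have "indep ?M I \<longleftrightarrow> transverse F A I"
      using that max_card_eq_card_iff[OF fin[OF that]]
      by (simp add: indep_def transversal_matroid_def)
    also have "\<dots> \<longleftrightarrow> partial_transversal (card F) (\<lambda>j. A (g j) \<inter> S) I"
    proof
      assume "transverse F A I"
      then obtain f where f: "inj_on f I" "\<forall>x\<in>I. f x \<in> F \<and> x \<in> A (f x)"
        unfolding transverse_def by blast
      have g': "bij_betw (inv_into {1..card F} g) F {1..card F}"
        using g bij_betw_inv_into by blast
      have "inj_on (inv_into {1..card F} g \<circ> f) I"
        using f g' by (intro comp_inj_on) (auto simp: bij_betw_def intro: inj_on_subset)
      moreover have "inv_into {1..card F} g (f x) \<in> {1..card F}"
        "g (inv_into {1..card F} g (f x)) = f x" if "x \<in> I" for x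
        using f(2) that g g' by (meson bij_betw_apply, meson bij_betw_inv_into_right)
      ultimately show "partial_transversal (card F) (\<lambda>j. A (g j) \<inter> S) I"
        unfolding partial_transversal_def using f \<open>I \<subseteq> S\<close>
        by (intro exI[of _ "inv_into {1..card F} g \<circ> f"]) auto
    next
      assume "partial_transversal (card F) (\<lambda>j. A (g j) \<inter> S) I"
      then obtain f where f: "inj_on f I" "\<forall>x\<in>I. f x \<in> {1..card F} \<and> x \<in> A (g (f x)) \<inter> S"
        unfolding partial_transversal_def by blast
      have "inj_on (g \<circ> f) I"
        using f g by (intro comp_inj_on) (auto simp: bij_betw_def intro: inj_on_subset)
      moreover have "g (f x) \<in> F" if "x \<in> I" for x
        using f g that bij_betw_apply by metis
      ultimately show "transverse F A I" unfolding transverse_def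
        using f by (intro exI[of _ "g \<circ> f"]) auto
    qed
    finally show ?thesis .
  qed
  then show ?thesis unfolding transversal_def
    using matroid
    by (intro conjI exI[of _ "card F"] exI[of _ "\<lambda>j. A (g j) \<inter> S"])
      (auto simp: transversal_matroid_def)
qed

lemma deletion_transversal_matroid:
  "deletion (transversal_matroid S F A) X = transversal_matroid (S - X) F A"
  unfolding deletion_def transversal_matroid_def by (auto simp: restrict_def fun_eq_iff)


section \<open>Labelings as matchings of edges with slots\<close>

text \<open>The slot number is unbounded here; the bound by the degree enters only through the
  ground set.\<close>

definition edge_slots :: "('v, 'e) multigraph \<Rightarrow> 'e \<Rightarrow> ('v \<times> nat) set" where
  "edge_slots G e = set_uprod (ends G e) \<times> UNIV"

abbreviation slot_rank :: "('v, 'e) multigraph \<Rightarrow> ('v \<times> nat) set \<Rightarrow> nat" where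
  "slot_rank G \<equiv> max_card (transverse (edges G) (edge_slots G))"

lemma alpha_mult: "alpha X v = card {p \<in> X. fst p = v}"
proof -
  have "{p \<in> X. fst p = v} = Pair v ` {i. (v, i) \<in> X}" by force
  then show ?thesis by (simp add: alpha_def card_image inj_on_def)
qed

text \<open>Each fibre of \<phi> injects into the slots of \<open>X\<close> over the same vertex.
  Different fibres cannot collide, since the first coordinate of a slot records its fibre.\<close>

lemma matching_of_orientation:
  assumes "finite D" "finite X" "\<forall>e\<in>D. card {e' \<in> D. \<phi> e' = \<phi> e} \<le> alpha X (\<phi> e)"
  obtains h where "inj_on h D" "\<forall>e\<in>D. h e \<in> X \<and> fst (h e) = \<phi> e"
proof -
  have "\<forall>v\<in>\<phi> ` D. \<exists>g. inj_on g {e' \<in> D. \<phi> e' = v} \<and>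
      g ` {e' \<in> D. \<phi> e' = v} \<subseteq> {p \<in> X. fst p = v}"
  proof
    fix v assume "v \<in> \<phi> ` D"
    then have "card {e' \<in> D. \<phi> e' = v} \<le> card {p \<in> X. fst p = v}"
      using assms(3) by (auto simp: alpha_mult)
    with card_le_inj[OF _ _ this] show "\<exists>g. inj_on g {e' \<in> D. \<phi> e' = v} \<and>
        g ` {e' \<in> D. \<phi> e' = v} \<subseteq> {p \<in> X. fst p = v}"
      using assms(1,2) by (simp add: conj_commute)
  qed
  from bchoice[OF this] obtain g
    where g: "\<forall>v\<in>\<phi> ` D. inj_on (g v) {e' \<in> D. \<phi> e' = v} \<and>
      g v ` {e' \<in> D. \<phi> e' = v} \<subseteq> {p \<in> X. fst p = v}" ..
  have h: "g (\<phi> e) e \<in> X \<and> fst (g (\<phi> e) e) = \<phi> e" if "e \<in> D" for e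
    using g that by blast
  have "inj_on (\<lambda>e. g (\<phi> e) e) D"
  proof (rule inj_onI)
    fix e e' assume *: "e \<in> D" "e' \<in> D" "g (\<phi> e) e = g (\<phi> e') e'"
    then have "\<phi> e = \<phi> e'" using h by metis
    then show "e = e'" using g * inj_onD[of "g (\<phi> e)" "{e' \<in> D. \<phi> e' = \<phi> e}" e e'] by simp
  qed
  then show ?thesis using h that by blast
qed

section \<open>Slots and labelings of a fixed finite multigraph\<close>

context
  fixes G :: "('v, 'e) multigraph"
  assumes fin_G: "finite_multigraph G"
begin

interpretation augmentable "transverse (edges G) (edge_slots G)"
  by (rule augmentable_transverse) (use fin_G in \<open>simp add: finite_multigraph_def\<close>)

lemma finite_edges: "finite (edges G)" and finite_verts: "finite (verts G)"
  and ends_in_verts: "e \<in> edges G \<Longrightarrow> v \<in> set_uprod (ends G e) \<Longrightarrow> v \<in> verts G"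
  using fin_G by (auto simp: finite_multigraph_def)

lemma slots_Sigma: "slots G W = Sigma W (\<lambda>v. {1..vdeg G v})"
  by (auto simp: slots_def)

lemma finite_slots: "W \<subseteq> verts G \<Longrightarrow> finite (slots G W)"
  using finite_verts by (auto simp: slots_Sigma intro: finite_subset)

lemma alpha_slots: "v \<in> W \<Longrightarrow> alpha (slots G W) v = vdeg G v"
proof -
  assume "v \<in> W"
  then have "{i. (v, i) \<in> slots G W} = {1..vdeg G v}" by (auto simp: slots_def)
  then show ?thesis by (simp add: alpha_def)
qed

text \<open>Reduces the construction of independent sets to counting, at each vertex, the edges
  directed to it.\<close>

lemma transverse_of_orientation:
  assumes "D \<subseteq> edges G" "finite X" "\<forall>e\<in>D. \<phi> e \<in> set_uprod (ends G e)"
    "\<forall>e\<in>D. card {e' \<in> D. \<phi> e' = \<phi> e} \<le> alpha X (\<phi> e)"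
  obtains I where "I \<subseteq> X" "transverse D (edge_slots G) I" "card I = card D"
proof -
  have "finite D" using assms(1) finite_edges finite_subset by blast
  then obtain h where h: "inj_on h D" "\<forall>e\<in>D. h e \<in> X \<and> fst (h e) = \<phi> e"
    using assms(2,4) by (rule matching_of_orientation)
  have "transverse D (edge_slots G) (h ` D)"
    unfolding transverse_iff_matching using h assms(3)
    by (intro exI[of _ D] exI[of _ h]) (auto simp: bij_betw_def edge_slots_def mem_Times_iff)
  then show ?thesis using that[of "h ` D"] h by (auto simp: card_image)
qed

text \<open>More than the maxima agree: the heights of labelings and the sizes of independent
  subsets of \<open>X\<close> form the same set of numbers.\<close>

lemma label_rank_eq:
  assumes X: "X \<subseteq> slots G (verts G)"
  shows "label_rank G X = int (slot_rank G X)"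
proof -
  have fX: "finite X" using X finite_slots finite_subset by blast
  have "{height G \<phi> |\<phi>. labeling G (alpha X) \<phi>}
      = card ` {I. I \<subseteq> X \<and> transverse (edges G) (edge_slots G) I}" (is "?L = ?R")
  proof (intro set_eqI iffI)
    fix n assume "n \<in> ?L"
    then obtain \<phi> where \<phi>: "labeling G (alpha X) \<phi>" and n: "n = height G \<phi>" by blast
    \<comment> \<open>The edges with a finite label; their labels choose one end each.\<close>
    define D where "D = {e \<in> edges G. \<phi> e \<noteq> None}"
    have ends: "\<forall>e\<in>D. the (\<phi> e) \<in> set_uprod (ends G e)"
      using \<phi> unfolding labeling_def D_def by fastforce
    have "card {e' \<in> D. the (\<phi> e') = the (\<phi> e)} \<le> alpha X (the (\<phi> e))" if "e \<in> D" for e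
    proof -
      have "{e' \<in> D. the (\<phi> e') = the (\<phi> e)} = {e' \<in> edges G. \<phi> e' = Some (the (\<phi> e))}"
        by (auto simp: D_def)
      moreover have "the (\<phi> e) \<in> verts G"
        using ends that ends_in_verts by (auto simp: D_def)
      ultimately show ?thesis using \<phi> by (simp add: labeling_def)
    qed
    moreover have DE: "D \<subseteq> edges G" by (auto simp: D_def)
    ultimately obtain I where I: "I \<subseteq> X" "transverse D (edge_slots G) I" "card I = card D"
      using transverse_of_orientation[OF _ fX ends] by metis
    have "transverse (edges G) (edge_slots G) I" using transverse_mono[OF I(2) DE] .
    moreover have "n = card I" using n I(3) by (simp add: height_def D_def)
    ultimately show "n \<in> ?R" using I(1) by blast
  next
    fix n assume "n \<in> ?R"
    then obtain I where I: "I \<subseteq> X" "transverse (edges G) (edge_slots G) I" "n = card I" by blast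
    then obtain D h where h: "D \<subseteq> edges G" "bij_betw h D I" "\<forall>e\<in>D. h e \<in> edge_slots G e"
      unfolding transverse_iff_matching by blast
    \<comment> \<open>Forget the slot number and keep its vertex; unmatched edges get the label
      \<open>None\<close>.\<close>
    define \<phi> where "\<phi> = restrict (\<lambda>e. if e \<in> D then Some (fst (h e)) else None) (edges G)"
    have hD: "h e \<in> X" "fst (h e) \<in> set_uprod (ends G e)" if "e \<in> D" for e
      using h I that by (auto simp: edge_slots_def bij_betw_def mem_Times_iff)
    have "card {e \<in> edges G. \<phi> e = Some v} \<le> alpha X v" for v
    proof -
      have "{e \<in> edges G. \<phi> e = Some v} = {e \<in> D. fst (h e) = v}"
        using h(1) by (auto simp: \<phi>_def split: if_splits)
      moreover have "card {e \<in> D. fst (h e) = v} \<le> card {p \<in> X. fst p = v}"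
        using h(2) hD fX by (intro card_inj_on_le[of h]) (auto simp: bij_betw_def intro: inj_on_subset)
      ultimately show ?thesis by (simp add: alpha_mult)
    qed
    moreover have "fst (h e) \<in> verts G" if "e \<in> D" for e
      using that h(1) hD ends_in_verts by blast
    ultimately have "labeling G (alpha X) \<phi>"
      unfolding labeling_def using hD by (auto simp: \<phi>_def)
    moreover have "{e \<in> edges G. \<phi> e \<noteq> None} = D" using h(1) by (auto simp: \<phi>_def split: if_splits)
    then have "n = height G \<phi>"
      using I(3) h(2) by (simp only: height_def bij_betw_same_card)
    ultimately show "n \<in> ?L" by blast
  qed
  then show ?thesis by (simp add: label_rank_def max_card_def)
qed

lemma label_matroid_eq:
  "label_matroid G = transversal_matroid (slots G (verts G)) (edges G) (edge_slots G)"
  unfolding label_matroid_def transversal_matroid_def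
  by (simp add: label_rank_eq cong: restrict_cong)

section \<open>Orientations and degree counting\<close>

lemma orientation_degrees:
  assumes "\<forall>e\<in>edges G. ends G e = Upair (\<phi> e) (\<psi> e)"
  shows "card {e \<in> edges G. \<phi> e = v} + card {e \<in> edges G. \<psi> e = v} = vdeg G v"
proof -
  \<comment> \<open>The union and the intersection of the two fibres give the two summands of
    \<open>vdeg\<close>, the intersection being the loops at \<open>v\<close>.\<close>
  have "{e \<in> edges G. \<phi> e = v} \<union> {e \<in> edges G. \<psi> e = v} = {e \<in> edges G. v \<in> set_uprod (ends G e)}"
    "{e \<in> edges G. \<phi> e = v} \<inter> {e \<in> edges G. \<psi> e = v} = {e \<in> edges G. ends G e = Upair v v}"
    using assms by auto
  then show ?thesis
    using card_Un_Int[of "{e \<in> edges G. \<phi> e = v}" "{e \<in> edges G. \<psi> e = v}"] finite_edges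
    by (simp add: vdeg_def)
qed

lemma other_ends:
  assumes "\<forall>e\<in>edges G. \<phi> e \<in> set_uprod (ends G e)"
  obtains \<psi> where "\<forall>e\<in>edges G. ends G e = Upair (\<phi> e) (\<psi> e)"
proof -
  have "\<exists>w. ends G e = Upair (\<phi> e) w" if "e \<in> edges G" for e
    using assms that by (cases "ends G e") (use insert_commute in \<open>force simp: Upair_inject\<close>)
  then show ?thesis using that by metis
qed

lemma orientation_exists:
  obtains \<phi> where "\<forall>e\<in>edges G. \<phi> e \<in> set_uprod (ends G e)"
proof -
  have "\<exists>w. w \<in> set_uprod (ends G e)" for e by (cases "ends G e") auto
  then show ?thesis using that by metis
qed

text \<open>The handshake lemma: an orientation and its reverse together account for all degrees,
  and each counts every edge once.\<close>

lemma card_slots: "card (slots G (verts G)) = 2 * card (edges G)"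
proof -
  obtain \<phi> where \<phi>: "\<forall>e\<in>edges G. \<phi> e \<in> set_uprod (ends G e)" by (rule orientation_exists)
  then obtain \<psi> where \<psi>: "\<forall>e\<in>edges G. ends G e = Upair (\<phi> e) (\<psi> e)" by (rule other_ends)
  have fibres: "(\<Sum>v\<in>verts G. card {e \<in> edges G. \<chi> e = v}) = card (edges G)"
    if "\<chi> ` edges G \<subseteq> verts G" for \<chi>
    using sum.group[OF finite_edges finite_verts that, of "\<lambda>_. 1 :: nat"] by simp
  have "card (slots G (verts G)) = (\<Sum>v\<in>verts G. vdeg G v)"
    using finite_verts by (simp add: slots_Sigma)
  also have "\<dots> = (\<Sum>v\<in>verts G. card {e \<in> edges G. \<phi> e = v} + card {e \<in> edges G. \<psi> e = v})"
    by (simp only: orientation_degrees[OF \<psi>])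
  also have "\<dots> = card (edges G) + card (edges G)"
    unfolding sum.distrib using \<psi> ends_in_verts by (subst (1 2) fibres) fastforce+
  finally show ?thesis by simp
qed

section \<open>Ranks of slot sets and of their complements\<close>

lemma transverse_card_le:
  assumes "transverse (edges G) (edge_slots G) I"
  shows "card I \<le> card (edges G)"
proof -
  obtain f where "inj_on f I" "f ` I \<subseteq> edges G" using assms unfolding transverse_def by blast
  then show ?thesis using finite_edges by (rule card_inj_on_le)
qed

text \<open>Direct every edge of \<open>T\<close> to an end in \<open>W\<close>. No vertex receives
  more edges than its degree, so the slots of \<open>W\<close> suffice.\<close>

lemma edges_meeting_transverse:
  assumes W: "W \<subseteq> verts G"
  defines "T \<equiv> {e \<in> edges G. set_uprod (ends G e) \<inter> W \<noteq> {}}"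
  obtains I where "I \<subseteq> slots G W" "transverse T (edge_slots G) I" "card I = card T"
proof -
  have TE: "T \<subseteq> edges G" by (auto simp: T_def)
  have "\<exists>w. w \<in> set_uprod (ends G e) \<and> (e \<in> T \<longrightarrow> w \<in> W)" for e
    by (cases "ends G e") (auto simp: T_def)
  then obtain \<phi> where \<phi>: "\<And>e. \<phi> e \<in> set_uprod (ends G e) \<and> (e \<in> T \<longrightarrow> \<phi> e \<in> W)" by metis
  then obtain \<psi> where \<psi>: "\<forall>e\<in>edges G. ends G e = Upair (\<phi> e) (\<psi> e)"
    using other_ends[of \<phi>] by blast
  have "card {e' \<in> T. \<phi> e' = \<phi> e} \<le> alpha (slots G W) (\<phi> e)" if "e \<in> T" for e
  proof -
    have "card {e' \<in> T. \<phi> e' = \<phi> e} \<le> card {e' \<in> edges G. \<phi> e' = \<phi> e}"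
      using TE finite_edges by (intro card_mono) auto
    also have "\<dots> \<le> vdeg G (\<phi> e)" using orientation_degrees[OF \<psi>, of "\<phi> e"] by simp
    finally show ?thesis using \<phi> that alpha_slots by simp
  qed
  then show ?thesis
    using transverse_of_orientation[OF TE finite_slots[OF W], of \<phi>] \<phi> that by blast
qed

text \<open>Every edge meets \<open>verts G\<close>, so all edges can be matched at once; the number
  of indices bounds the rank from above.\<close>

lemma slot_rank_slots: "slot_rank G (slots G (verts G)) = card (edges G)"
proof -
  have "set_uprod (ends G e) \<inter> verts G \<noteq> {}" if "e \<in> edges G" for e
    using ends_in_verts[OF that] by (cases "ends G e") auto
  then have all: "{e \<in> edges G. set_uprod (ends G e) \<inter> verts G \<noteq> {}} = edges G" by blast
  obtain I where I: "I \<subseteq> slots G (verts G)" "transverse (edges G) (edge_slots G) I"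
      "card I = card (edges G)"
    by (rule edges_meeting_transverse[OF order.refl, unfolded all])
  then have "card (edges G) \<le> slot_rank G (slots G (verts G))"
    using max_card_ge[OF finite_slots[OF order.refl] I(1,2)] by simp
  moreover obtain J where "transverse (edges G) (edge_slots G) J"
      "card J = slot_rank G (slots G (verts G))"
    using max_card_witness[OF finite_slots[OF order.refl]] by metis
  ultimately show ?thesis using transverse_card_le[of J] by simp
qed

text \<open>Matching every edge with a slot of its other end turns a basis into its complement.\<close>

lemma transverse_complement:
  assumes B: "B \<subseteq> slots G (verts G)" "transverse (edges G) (edge_slots G) B"
    "card B = card (edges G)"
  shows "transverse (edges G) (edge_slots G) (slots G (verts G) - B)"
proof -
  let ?S = "slots G (verts G)"
  have fS: "finite ?S" by (simp add: finite_slots)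
  have fB: "finite B" using B(1) fS finite_subset by blast
  obtain D h where h: "D \<subseteq> edges G" "bij_betw h D B" "\<forall>e\<in>D. h e \<in> edge_slots G e"
    using B(2) unfolding transverse_iff_matching by blast
  \<comment> \<open>A basis has as many elements as there are edges, so no edge is idle.\<close>
  have "D = edges G"
    using h B(3) finite_edges by (metis bij_betw_same_card card_subset_eq)
  note h = h[unfolded this]
  have ends: "\<forall>e\<in>edges G. fst (h e) \<in> set_uprod (ends G e)"
    using h(3) by (auto simp: edge_slots_def mem_Times_iff)
  then obtain \<psi> where \<psi>: "\<forall>e\<in>edges G. ends G e = Upair (fst (h e)) (\<psi> e)"
    by (rule other_ends)
  \<comment> \<open>The slots at \<open>v\<close> outside \<open>B\<close> number the degree minus
    the edges directed to \<open>v\<close> by \<open>h\<close>, which is the number of edges whose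
    other end is \<open>v\<close>.\<close>
  have "card {e' \<in> edges G. \<psi> e' = v} = alpha (?S - B) v" if "v \<in> verts G" for v
  proof -
    have "h ` {e \<in> edges G. fst (h e) = v} = {p \<in> B. fst p = v}"
      using h(2) by (auto simp: bij_betw_def)
    moreover have "inj_on h {e \<in> edges G. fst (h e) = v}"
      using h(2) by (auto simp: bij_betw_def intro: inj_on_subset)
    ultimately have "card {e \<in> edges G. fst (h e) = v} = card {p \<in> B. fst p = v}"
      using card_image[of h "{e \<in> edges G. fst (h e) = v}"] by simp
    moreover have "alpha (?S - B) v = vdeg G v - card {p \<in> B. fst p = v}"
    proof -
      have "{p \<in> ?S - B. fst p = v} = {p \<in> ?S. fst p = v} - {p \<in> B. fst p = v}" by auto
      moreover have "{p \<in> B. fst p = v} \<subseteq> {p \<in> ?S. fst p = v}" using B(1) by auto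
      ultimately show ?thesis
        using fB alpha_slots[OF that] by (simp add: alpha_mult card_Diff_subset)
    qed
    ultimately show ?thesis using orientation_degrees[OF \<psi>, of v] by simp
  qed
  then have le: "\<forall>e\<in>edges G. card {e' \<in> edges G. \<psi> e' = \<psi> e} \<le> alpha (?S - B) (\<psi> e)"
    using \<psi> ends_in_verts by simp
  have "\<forall>e\<in>edges G. \<psi> e \<in> set_uprod (ends G e)" using \<psi> by simp
  then obtain I where I: "I \<subseteq> ?S - B" "transverse (edges G) (edge_slots G) I"
      "card I = card (edges G)"
    using le by (rule transverse_of_orientation[OF order.refl finite_Diff[OF fS]])
  \<comment> \<open>By the handshake count the complement of \<open>B\<close> has exactly the size
    of \<open>I\<close>, so \<open>I\<close> fills it.\<close>
  moreover have "card (?S - B) = card (edges G)"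
    using B fB by (simp add: card_Diff_subset card_slots)
  ultimately have "I = ?S - B" using fS by (intro card_subset_eq) auto
  then show ?thesis using I(2) by simp
qed

text \<open>Self-duality in terms of ranks. Extend a maximum independent subset of \<open>X\<close>
  to a basis \<open>B\<close>; the complement of \<open>B\<close> is independent, and its part
  outside \<open>X\<close> bounds the rank of the complement of \<open>X\<close> from below.\<close>

lemma slot_rank_complement:
  assumes X: "X \<subseteq> slots G (verts G)"
  shows "slot_rank G (slots G (verts G) - X) + card X = slot_rank G X + card (edges G)"
proof -
  let ?S = "slots G (verts G)"
  have fS: "finite ?S" by (simp add: finite_slots)
  have ge: "slot_rank G X + card (edges G) \<le> slot_rank G (?S - X) + card X"
    if X: "X \<subseteq> ?S" for X
  proof -
    have fX: "finite X" using X fS finite_subset by blast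
    obtain I where I: "I \<subseteq> X" "transverse (edges G) (edge_slots G) I" "card I = slot_rank G X"
      using fX by (rule max_card_witness)
    obtain B where B: "I \<subseteq> B" "B \<subseteq> ?S" "transverse (edges G) (edge_slots G) B"
        "card B = card (edges G)"
      using extend_to_max_card[OF fS subset_trans[OF I(1) X] I(2)] slot_rank_slots by metis
    have fB: "finite B" using B fS finite_subset by blast
    have "transverse (edges G) (edge_slots G) (?S - (B \<union> X))"
      using transverse_subset[OF transverse_complement[OF B(2-4)]] by blast
    then have "card (?S - (B \<union> X)) \<le> slot_rank G (?S - X)"
      using fS by (intro max_card_ge) auto
    moreover have "card (?S - (B \<union> X)) = 2 * card (edges G) - card (B \<union> X)"
      using B X fX fB by (simp add: card_Diff_subset card_slots)
    moreover have "card I \<le> card (B \<inter> X)" using I B fB by (intro card_mono) auto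
    moreover have "card B + card X = card (B \<union> X) + card (B \<inter> X)"
      using card_Un_Int fB fX by blast
    ultimately show ?thesis using I B by linarith
  qed
  \<comment> \<open>The reverse inequality is \<open>ge\<close> applied to the complement of
    \<open>X\<close>.\<close>
  have "?S - (?S - X) = X" using X by auto
  moreover have "card (?S - X) = 2 * card (edges G) - card X" "card X \<le> 2 * card (edges G)"
    using card_Diff_subset[OF finite_subset[OF X fS] X] card_mono[OF fS X] card_slots by simp_all
  ultimately show ?thesis using ge[OF X] ge[of "?S - X"] by auto
qed

text \<open>The rank formula behind contracting the slots of \<open>W\<close>. An edge outside
  \<open>T\<close> has no end in \<open>W\<close>, so it can only use slots in \<open>Y\<close>,
  while \<open>T\<close> adds at most its size. Conversely, matching \<open>T\<close> inside the
  slots of \<open>W\<close> leaves \<open>Y\<close> to the other edges.\<close>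

lemma slot_rank_slots_Un:
  assumes W: "W \<subseteq> verts G" and Y: "Y \<subseteq> slots G (verts G) - slots G W"
  defines "T \<equiv> {e \<in> edges G. set_uprod (ends G e) \<inter> W \<noteq> {}}"
  shows "slot_rank G (slots G W \<union> Y)
    = card T + max_card (transverse (edges G - T) (edge_slots G)) Y"
proof -
  interpret N: augmentable "transverse (edges G - T) (edge_slots G)"
    by (rule augmentable_transverse) (simp add: finite_edges)
  have fY: "finite Y" using Y finite_slots[of "verts G"] by (meson finite_Diff finite_subset order.refl)
  have fX: "finite (slots G W \<union> Y)" using fY finite_slots[OF W] by simp
  have TE: "T \<subseteq> edges G" by (auto simp: T_def)
  show ?thesis
  proof (rule antisym)
    obtain I where I: "I \<subseteq> slots G W \<union> Y" "transverse (edges G) (edge_slots G) I"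
        "card I = slot_rank G (slots G W \<union> Y)"
      using fX by (rule max_card_witness)
    then obtain D h where h: "D \<subseteq> edges G" "bij_betw h D I" "\<forall>e\<in>D. h e \<in> edge_slots G e"
      unfolding transverse_iff_matching by blast
    have fD: "finite D" using h finite_edges finite_subset by blast
    have inj: "inj_on h (D - T)" using h(2) by (auto simp: bij_betw_def intro: inj_on_subset)
    have "h e \<in> Y" if "e \<in> D - T" for e
    proof -
      have "h e \<in> slots G W \<union> Y" using that h(2) I(1) by (auto simp: bij_betw_def)
      moreover have "fst (h e) \<notin> W" using that h by (auto simp: T_def edge_slots_def mem_Times_iff)
      ultimately show ?thesis by (auto simp: slots_def)
    qed
    moreover have "transverse (edges G - T) (edge_slots G) (h ` (D - T))"
      unfolding transverse_iff_matching using h inj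
      by (intro exI[of _ "D - T"] exI[of _ h]) (auto simp: bij_betw_def)
    ultimately have "card (D - T) \<le> max_card (transverse (edges G - T) (edge_slots G)) Y"
      using N.max_card_ge[OF fY, of "h ` (D - T)"] inj by (auto simp: card_image)
    moreover have "card D \<le> card T + card (D - T)"
      using fD TE finite_edges finite_subset
      by (metis (no_types, opaque_lifting) Un_Diff_cancel Un_upper2 card_Un_le card_mono finite_Diff finite_UnI le_trans)
    ultimately show "slot_rank G (slots G W \<union> Y)
        \<le> card T + max_card (transverse (edges G - T) (edge_slots G)) Y"
      using I(3) h(2) by (simp add: bij_betw_same_card)
  next
    obtain I where I: "I \<subseteq> slots G W" "transverse T (edge_slots G) I" "card I = card T"
      using edges_meeting_transverse[OF W] unfolding T_def by blast
    obtain J where J: "J \<subseteq> Y" "transverse (edges G - T) (edge_slots G) J"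
        "card J = max_card (transverse (edges G - T) (edge_slots G)) Y"
      using fY by (rule N.max_card_witness)
    have "transverse (edges G) (edge_slots G) (I \<union> J)"
      using transverse_union[OF I(2) J(2)] TE by (simp add: Un_absorb1)
    then have "card (I \<union> J) \<le> slot_rank G (slots G W \<union> Y)"
      using I J fX by (intro max_card_ge) auto
    moreover have "card (I \<union> J) = card I + card J"
      using I J Y fX by (intro card_Un_disjoint) (auto intro: finite_subset)
    ultimately show "card T + max_card (transverse (edges G - T) (edge_slots G)) Y
        \<le> slot_rank G (slots G W \<union> Y)"
      using I J by simp
  qed
qed

section \<open>Self-duality and the duals of deletions\<close>

lemma matroid_dual_label_matroid: "matroid_dual (label_matroid G) = label_matroid G"
proof -
  let ?S = "slots G (verts G)"
  have "int (card X) + int (slot_rank G (?S - X)) - int (card (edges G)) = int (slot_rank G X)"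
    if "X \<subseteq> ?S" for X
    using slot_rank_complement[OF that] by linarith
  then show ?thesis
    unfolding label_matroid_eq matroid_dual_def transversal_matroid_def
    by (simp add: slot_rank_slots cong: restrict_cong)
qed

text \<open>By self-duality the dual of \<open>M \ X\<close> is the contraction \<open>M / X\<close>. All edges meeting \<open>W\<close> can be
  matched inside the slots of \<open>W\<close>, so contracting these slots removes exactly those edges.\<close>

lemma matroid_dual_deletion:
  assumes W: "W \<subseteq> verts G"
  shows "matroid_dual (deletion (label_matroid G) (slots G W)) =
    transversal_matroid (slots G (verts G) - slots G W)
      {e \<in> edges G. set_uprod (ends G e) \<inter> W = {}} (edge_slots G)"
proof -
  let ?S = "slots G (verts G)" and ?X = "slots G W"
  define T where "T = {e \<in> edges G. set_uprod (ends G e) \<inter> W \<noteq> {}}"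
  let ?r = "max_card (transverse (edges G - T) (edge_slots G))"
  interpret N: augmentable "transverse (edges G - T) (edge_slots G)"
    by (rule augmentable_transverse) (simp add: finite_edges)
  have XS: "?X \<subseteq> ?S" using W by (auto simp: slots_def)
  have T: "{e \<in> edges G. set_uprod (ends G e) \<inter> W = {}} = edges G - T" by (auto simp: T_def)
  \<comment> \<open>The dual rank of \<open>Y\<close> in the deletion. Complementation at
    \<open>?X \<union> Y\<close> and at \<open>?X\<close> turns it into the difference of their
    ranks, where the terms \<open>card T\<close> cancel.\<close>
  have "int (card Y) + int (slot_rank G (?S - ?X - Y)) - int (slot_rank G (?S - ?X)) = int (?r Y)"
    if Y: "Y \<subseteq> ?S - ?X" for Y
  proof -
    have fin: "finite ?X" "finite Y"
      using XS Y finite_slots[of "verts G"] by (meson finite_Diff finite_subset order.refl)+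
    have "?S - ?X - Y = ?S - (?X \<union> Y)" by auto
    then have "slot_rank G (?S - ?X - Y) + card (?X \<union> Y) = slot_rank G (?X \<union> Y) + card (edges G)"
      using slot_rank_complement[of "?X \<union> Y"] XS Y by auto
    moreover have "slot_rank G (?S - ?X) + card ?X = slot_rank G ?X + card (edges G)"
      using slot_rank_complement[OF XS] .
    moreover have "slot_rank G (?X \<union> Y) = card T + ?r Y"
      using slot_rank_slots_Un[OF W Y] unfolding T_def .
    moreover have "slot_rank G ?X = card T"
      using slot_rank_slots_Un[OF W, of "{}"] N.max_card_le_card[of "{}"] by (simp add: T_def)
    moreover have "card (?X \<union> Y) = card ?X + card Y"
      using fin Y by (intro card_Un_disjoint) auto
    ultimately show ?thesis by linarith
  qed
  then show ?thesis
    unfolding T label_matroid_eq deletion_transversal_matroid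
    unfolding matroid_dual_def transversal_matroid_def
    by (simp cong: restrict_cong)
qed

text \<open>The deletion is presented by all edges on the smaller ground set, its dual by the edges
  avoiding \<open>W\<close>.\<close>

lemma bi_transversal_deletion:
  assumes "perfect G X"
  shows "bi_transversal (deletion (label_matroid G) X)"
proof -
  obtain W where W: "W \<subseteq> verts G" and X: "X = slots G W"
    using assms by (auto simp: perfect_def)
  have "finite (slots G (verts G) - slots G W)" by (simp add: finite_slots)
  then have "transversal (deletion (label_matroid G) X)"
      "transversal (matroid_dual (deletion (label_matroid G) X))"
    unfolding X matroid_dual_deletion[OF W] unfolding label_matroid_eq deletion_transversal_matroid
    using finite_edges by (auto intro: transversal_transversal_matroid)
  then show ?thesis by (simp add: bi_transversal_def)
qed

end

theorem theorem1p1: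
  fixes G :: "('v, 'e) multigraph"
  assumes "finite_multigraph G"
  shows "is_matroid (label_matroid G) \<and>
         matroid_dual (label_matroid G) = label_matroid G \<and>
         transversal (label_matroid G) \<and>
         rk (label_matroid G) (ground (label_matroid G)) = int (card (edges G)) \<and>
         (\<forall>X. X \<subseteq> slots G (verts G) \<and> perfect G X \<longrightarrow>
            bi_transversal (deletion (label_matroid G) X))"
proof -
  have T: "transversal (label_matroid G)"
    unfolding label_matroid_eq[OF assms]
    using finite_slots[OF assms] finite_edges[OF assms]
    by (auto intro: transversal_transversal_matroid)
  have "rk (label_matroid G) (ground (label_matroid G)) = int (card (edges G))"
    unfolding label_matroid_eq[OF assms]
    by (simp add: transversal_matroid_def slot_rank_slots[OF assms])
  then show ?thesis
    using T matroid_dual_label_matroid[OF assms] bi_transversal_deletion[OF assms]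
    by (auto simp: transversal_def)
qed

end
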